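(* Let $E_1|H_1,\ldots,E_n|H_n$ be $n$ conditional events, with all previsions involved coherently assessed. Let $\mathscr{D}_{1\cdots n}=(E_1|H_1)\vee\cdots\vee(E_n|H_n)$ be their disjunction and, for $1\le i_1<\cdots<i_h\le n$, let $\mathscr{C}_{i_1\cdots i_h}=(E_{i_1}|H_{i_1})\wedge\cdots\wedge(E_{i_h}|H_{i_h})$. Then \[ \mathscr{D}_{1\cdots n}=\sum_{h=1}^n(-1)^{h+1}\sum_{1\le i_1<\cdots<i_h\le n}\mathscr{C}_{i_1\cdots i_h}=\sum_{i=1}^n\mathscr{C}_i-\sum_{1\le i_1<i_2\le n}\mathscr{C}_{i_1i_2}+\cdots+(-1)^{n+1}\mathscr{C}_{1\cdots n}. \]
   Context: Events. Events are elements of a Boolean algebra with top $\Omega$ (sure event) and bottom $\emptyset$ (impossible event); one may take subsets of a set $\Omega$. An event is identified with its $0/1$ indicator; $EF$ or $E\wedge F$ is conjunction, $E\vee F$ disjunction, $\overline{E}$ negation. Conditional random quantities. Given an event $H\neq\emptyset$, a random quantity $X$ (a real-valued function on $\Omega$ with finitely many values on $H$) and an assessed real number $\mu=\mathbb{P}(X|H)$ (the conditional prevision), the conditional random quantity $X|H$ is $XH+\mu\overline{H}$ (value $X$ if $H$ is true, $\mu$ if $H$ is false). For a conditional event $E|H$ with $P(E|H)=x$, its indicator (same symbol) is $E|H=EH+x\overline{H}$; it is true, false or void when $EH$, $\overline{E}H$ or $\overline{H}$ is true, respectively. Coherence. A prevision assessment on a family of conditional random quantities is coherent if for every finite subfamily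 $X_1|H_1,\ldots,X_m|H_m$ with assessed previsions $\mu_1,\ldots,\mu_m$ and all real $s_1,\ldots,s_m$, the random gain $G=\sum_{i=1}^m s_iH_i(X_i-\mu_i)$, restricted to $H_1\vee\cdots\vee H_m$, satisfies $\min G\le 0\le\max G$. Conjunction. For a finite family $(A_i|K_i)_{i\in T}$ of conditional events, the conjunctions $\mathscr{C}_S=\bigwedge_{i\in S}(A_i|K_i)$, $\emptyset\ne S\subseteq T$, with assessed previsions $x_S=\mathbb{P}(\mathscr{C}_S)$, are defined recursively on $|S|$ by \[ \mathscr{C}_S=\Big[\bigwedge_{i\in S}A_iK_i+\sum_{\emptyset\neq R\subsetneq S}x_R\Big(\bigwedge_{i\in R}\overline{K}_i\Big)\wedge\Big(\bigwedge_{i\in S\setminus R}A_iK_i\Big)\Big]\Big|\Big(\bigvee_{i\in S}K_i\Big), \] i.e. $\mathscr{C}_S$ has value $1$ if all $A_iK_i$ ($i\in S$) are true; $0$ if some $\overline{A}_iK_i$ is true; $x_R$ if exactly the conditional events with index in $R$ are void and the others are true ($\emptyset\ne R\subsetneq S$); $x_S$ if all $K_i$, $i\in S$, are false. For $S=\{i\}$, $\mathscr{C}_S=A_i|K_i$. Disjunction. Similarly, the disjunctions $\mathscr{D}_S=\bigvee_{i\in S}(A_i|K_i)$, with assessed previsions $y_S=\mathbb{P}(\mathscr{D}_S)$, are defined recursively by \[ \mathscr{D}_S=\Big[\bigvee_{i\in S}A_iK_i+\sum_{\emptyset\neq R\subsetneq S}y_R\Big(\bigwedge_{i\in R}\overline{K}_i\Big)\wedge\Big(\bigwedge_{i\in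 S\setminus R}\overline{A}_iK_i\Big)\Big]\Big|\Big(\bigvee_{i\in S}K_i\Big), \] i.e. value $1$ if some $A_iK_i$ is true; $0$ if all $\overline{A}_iK_i$ are true; $y_R$ if exactly the conditional events with index in $R$ are void and the others are false; $y_S$ if all $K_i$, $i\in S$, are false. Standing assumption. The previsions assessed for all conditional events $E_i|H_i$, $\overline{E}_i|H_i$ and all conjunctions and disjunctions involved form a coherent assessment. Equality of conditional random quantities means equality of values in all cases (as functions on $\Omega$). *)

theory Defs
  imports Complex_Main "HOL-Library.Indicator_Function"
begin

text \<open>
  The sure event \<open>\<Omega>\<close> is the whole type \<open>'w\<close>, and events are sets over it.
  A triple \<open>(X, H, \<mu>)\<close> is a random quantity \<open>X\<close>, a conditioning event \<open>H\<close> and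
  the assessed prevision \<open>\<mu>\<close> of \<open>X|H\<close>.  The values of \<open>X\<close> outside \<open>H\<close> are irrelevant.
\<close>

type_synonym 'w assessed = "('w \<Rightarrow> real) \<times> 'w set \<times> real"

fun crq :: "'w assessed \<Rightarrow> 'w \<Rightarrow> real" where
  "crq (X, H, \<mu>) w = X w * indicator H w + \<mu> * indicator (- H) w"

text \<open>
  A (possibly infinite) assessment is a set of such triples: listing the same triple
  twice in a family only adds up its coefficients in the gain, while two different
  previsions for the same \<open>X|H\<close> are two different triples.
\<close>

definition gain :: "'w assessed set \<Rightarrow> ('w assessed \<Rightarrow> real) \<Rightarrow> 'w \<Rightarrow> real" where
  "gain F s w = (\<Sum>(X, H, \<mu>)\<in>F. s (X, H, \<mu>) * indicator H w * (X w - \<mu>))"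

text \<open>
  The first conjunct says that the members of the assessment are conditional random
  quantities at all; it makes the sets below finite and nonempty, so that \<open>Min\<close> and
  \<open>Max\<close> are meaningful.
\<close>

definition coherent :: "'w assessed set \<Rightarrow> bool" where
  "coherent \<A> \<longleftrightarrow>
     (\<forall>(X, H, \<mu>)\<in>\<A>. H \<noteq> {} \<and> finite (X ` H)) \<and>
     (\<forall>F s. finite F \<and> F \<noteq> {} \<and> F \<subseteq> \<A> \<longrightarrow>
        (let U = (\<Union>(X, H, \<mu>)\<in>F. H)
         in Min (gain F s ` U) \<le> 0 \<and> 0 \<le> Max (gain F s ` U)))"

text \<open>
  In the following, \<open>A i|K i\<close> are conditional events, and \<open>x S\<close>, \<open>y S\<close> are the previsions
  assessed for the conjunction and the disjunction over the index set \<open>S\<close>.  The recursion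
  on the size of \<open>S\<close> goes through these previsions only: the conjunction over \<open>S\<close> refers
  to those over the smaller sets \<open>R\<close> solely by their previsions \<open>x R\<close>.
\<close>

definition cond_conj ::
  "('i \<Rightarrow> 'w set) \<Rightarrow> ('i \<Rightarrow> 'w set) \<Rightarrow> ('i set \<Rightarrow> real) \<Rightarrow> 'i set \<Rightarrow> 'w assessed" where
  "cond_conj A K x S =
     (\<lambda>w. indicator (\<Inter>i\<in>S. A i \<inter> K i) w
        + (\<Sum>R | R \<noteq> {} \<and> R \<subset> S.
             x R * indicator ((\<Inter>i\<in>R. - K i) \<inter> (\<Inter>i\<in>S - R. A i \<inter> K i)) w),
      (\<Union>i\<in>S. K i),
      x S)"

definition cond_disj ::
  "('i \<Rightarrow> 'w set) \<Rightarrow> ('i \<Rightarrow> 'w set) \<Rightarrow> ('i set \<Rightarrow> real) \<Rightarrow> 'i set \<Rightarrow> 'w assessed" where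
  "cond_disj A K y S =
     (\<lambda>w. indicator (\<Union>i\<in>S. A i \<inter> K i) w
        + (\<Sum>R | R \<noteq> {} \<and> R \<subset> S.
             y R * indicator ((\<Inter>i\<in>R. - K i) \<inter> (\<Inter>i\<in>S - R. - A i \<inter> K i)) w),
      (\<Union>i\<in>S. K i),
      y S)"

text \<open>
  The assessment on all \<open>A i|K i\<close> (whose prevision is \<open>x {i}\<close>, since it is the conjunction
  over \<open>{i}\<close>), on their negations \<open>(- A i)|K i\<close> with previsions \<open>z i\<close>, and on all
  conjunctions and disjunctions over nonempty subsets of \<open>T\<close>.  Coherence forces
  \<open>y {i} = x {i}\<close>, the disjunction over \<open>{i}\<close> being \<open>A i|K i\<close> as well.
\<close>

definition assessment ::
  "('i \<Rightarrow> 'w set) \<Rightarrow> ('i \<Rightarrow> 'w set) \<Rightarrow> 'i set \<Rightarrow>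
   ('i set \<Rightarrow> real) \<Rightarrow> ('i set \<Rightarrow> real) \<Rightarrow> ('i \<Rightarrow> real) \<Rightarrow> 'w assessed set" where
  "assessment A K T x y z =
     {(indicator (A i), K i, x {i}) | i. i \<in> T} \<union>
     {(indicator (- A i), K i, z i) | i. i \<in> T} \<union>
     {cond_conj A K x S | S. S \<noteq> {} \<and> S \<subseteq> T} \<union>
     {cond_disj A K y S | S. S \<noteq> {} \<and> S \<subseteq> T}"

end

theory Submission imports Defs begin

text \<open>
  Fix an outcome \<open>w\<close> and let \<open>V\<close> be the set of indices in \<open>S\<close> whose conditional events are
  void at \<open>w\<close>.  With the conventions \<open>x \<emptyset> = 1\<close> and \<open>y \<emptyset> = 0\<close>, the conjunction over \<open>S\<close> has
  value \<open>x V\<close> at \<open>w\<close> unless some member is false (and then it has value \<open>0\<close>), and the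
  disjunction over \<open>S\<close> has value \<open>y V\<close> unless some member is true (and then it has value
  \<open>1\<close>); these are \<open>crq_cond_conj\<close> and \<open>crq_cond_disj\<close>.

  The inclusion-exclusion sum of the conjunctions can therefore be computed at \<open>w\<close>.  If some
  member is true, adding it to or removing it from an index set leaves the value of the
  conjunction unchanged, so all terms cancel against each other except for the one facing the
  empty index set, which contributes \<open>1\<close>.  If no member is true, only the sets \<open>R \<subseteq> V\<close> survive
  and the sum is the inclusion-exclusion sum of the previsions \<open>x R\<close>.  Hence the theorem holds
  at \<open>w\<close> as soon as \<open>y V\<close> is the inclusion-exclusion sum of the \<open>x R\<close> with \<open>\<emptyset> \<noteq> R \<subseteq> V\<close>
  (\<open>incl_excl_at_outcome\<close>).

  This relation between previsions is where coherence enters (\<open>incl_excl_prevision\<close>).  It is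
  proved by induction on the size of \<open>S\<close>: if some conditioning event of \<open>S\<close> occurs, the void
  set is a proper subset of \<open>S\<close>, so by induction the identity between the random quantities
  holds on the union of the conditioning events.  Coherence then transfers the identity to the
  previsions, since a linear combination that is constant there gives a constant gain,
  which has to be \<open>0\<close> (\<open>coherent_linear\<close>).
\<close>

section \<open>Coherence and linear relations\<close>

text \<open>
  The gain of a bet on \<open>X|H\<close> is a multiple of the difference between the value of \<open>X|H\<close> and its
  prevision, so the hypothesis makes the gain of the combined bet constant on the union of
  the conditioning events, and coherence leaves \<open>0\<close> as the only constant.  The family is
  indexed because distinct indices may carry the same triple.
\<close>

lemma coherent_linear:
  fixes c :: "'j \<Rightarrow> real" and f :: "'j \<Rightarrow> 'w assessed"
  assumes coh: "coherent \<A>" and J: "finite J" "J \<noteq> {}" and f: "f ` J \<subseteq> \<A>"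
    and const: "\<And>w. w \<in> (\<Union>j\<in>J. fst (snd (f j))) \<Longrightarrow> (\<Sum>j\<in>J. c j * crq (f j) w) = k"
  shows "(\<Sum>j\<in>J. c j * snd (snd (f j))) = k"
proof -
  define s where "s t = (\<Sum>j | j \<in> J \<and> f j = t. c j)" for t
  define U where "U = (\<Union>j\<in>J. fst (snd (f j)))"
  let ?d = "k - (\<Sum>j\<in>J. c j * snd (snd (f j)))"
  have term_eq: "(case t of (X, H, \<mu>) \<Rightarrow> a (X, H, \<mu>) * indicator H w * (X w - \<mu>))
      = a t * (crq t w - snd (snd t))" for t and a :: "'w assessed \<Rightarrow> real" and w
    by (cases t) (auto simp: indicator_def)
  have gain_eq: "gain (f ` J) s w = (\<Sum>j\<in>J. c j * (crq (f j) w - snd (snd (f j))))" for w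
  proof -
    have "gain (f ` J) s w = (\<Sum>t\<in>f ` J. s t * (crq t w - snd (snd t)))"
      unfolding gain_def by (intro sum.cong refl term_eq)
    also have "\<dots> = (\<Sum>t\<in>f ` J. \<Sum>j | j \<in> J \<and> f j = t. c j * (crq (f j) w - snd (snd (f j))))"
      unfolding s_def by (intro sum.cong refl) (simp add: sum_distrib_right)
    also have "\<dots> = (\<Sum>j\<in>J. c j * (crq (f j) w - snd (snd (f j))))"
      by (rule sum.image_gen [OF J(1), symmetric])
    finally show ?thesis .
  qed
  have gain_const: "gain (f ` J) s w = ?d" if "w \<in> U" for w
    using const [of w] that
    by (simp add: gain_eq U_def right_diff_distrib sum_subtractf)
  have "(\<Union>(X, H, \<mu>)\<in>f ` J. H) = U"
    by (simp add: U_def split_beta)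
  moreover have "\<forall>F s. finite F \<and> F \<noteq> {} \<and> F \<subseteq> \<A> \<longrightarrow>
      Min (gain F s ` (\<Union>(X, H, \<mu>)\<in>F. H)) \<le> 0 \<and>
      0 \<le> Max (gain F s ` (\<Union>(X, H, \<mu>)\<in>F. H))"
    using coh unfolding coherent_def Let_def by (rule conjunct2)
  from this [rule_format, of "f ` J" s] have "Min (gain (f ` J) s ` (\<Union>(X, H, \<mu>)\<in>f ` J. H)) \<le> 0"
    "0 \<le> Max (gain (f ` J) s ` (\<Union>(X, H, \<mu>)\<in>f ` J. H))"
    using J f by simp_all
  ultimately have le: "Min (gain (f ` J) s ` U) \<le> 0" "0 \<le> Max (gain (f ` J) s ` U)"
    by simp_all
  obtain j where "j \<in> J" using J(2) by blast
  then have "f j \<in> \<A>"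
    using f by blast
  moreover have "\<forall>(X, H, \<mu>)\<in>\<A>. H \<noteq> {} \<and> finite (X ` H)"
    using coh unfolding coherent_def by (rule conjunct1)
  ultimately have "fst (snd (f j)) \<noteq> {}"
    unfolding split_beta by blast
  then have "U \<noteq> {}"
    using \<open>j \<in> J\<close> by (auto simp: U_def)
  then have "gain (f ` J) s ` U = {?d}"
    using gain_const by (simp add: image_constant_conv cong: image_cong_simp)
  then show ?thesis
    using le by simp
qed

section \<open>Values of conjunctions and disjunctions\<close>

definition void :: "('i \<Rightarrow> 'w set) \<Rightarrow> 'i set \<Rightarrow> 'w \<Rightarrow> 'i set" where
  "void K S w = {i \<in> S. w \<notin> K i}"

text \<open>
  The constituents in the defining sums are disjoint: the one indexed by \<open>R\<close> can only occur
  at outcomes whose void set is \<open>R\<close>.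
\<close>

lemma sum_constituents:
  fixes x :: "'i set \<Rightarrow> real"
  assumes "finite S"
  shows "(\<Sum>R | R \<noteq> {} \<and> R \<subset> S.
      x R * indicator ((\<Inter>i\<in>R. - K i) \<inter> (\<Inter>i\<in>S - R. B i \<inter> K i)) w)
    = (if void K S w \<noteq> {} \<and> void K S w \<noteq> S \<and> (\<forall>i\<in>S - void K S w. w \<in> B i)
       then x (void K S w) else 0)"
proof -
  let ?V = "void K S w"
  let ?b = "\<forall>i\<in>S - ?V. w \<in> B i"
  have fin: "finite {R. R \<noteq> {} \<and> R \<subset> S}"
    by (rule finite_subset [of _ "Pow S"]) (use assms in auto)
  have "(\<Sum>R | R \<noteq> {} \<and> R \<subset> S.
      x R * indicator ((\<Inter>i\<in>R. - K i) \<inter> (\<Inter>i\<in>S - R. B i \<inter> K i)) w)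
    = (\<Sum>R | R \<noteq> {} \<and> R \<subset> S. if R = ?V then (if ?b then x R else 0) else 0)"
  proof (intro sum.cong refl)
    fix R assume "R \<in> {R. R \<noteq> {} \<and> R \<subset> S}"
    then have "w \<in> (\<Inter>i\<in>R. - K i) \<inter> (\<Inter>i\<in>S - R. B i \<inter> K i) \<longleftrightarrow> R = ?V \<and> ?b"
      by (auto simp: void_def)
    then show "x R * indicator ((\<Inter>i\<in>R. - K i) \<inter> (\<Inter>i\<in>S - R. B i \<inter> K i)) w
        = (if R = ?V then (if ?b then x R else 0) else 0)"
      by (simp add: indicator_def)
  qed
  also have "\<dots> = (if ?V \<noteq> {} \<and> ?V \<noteq> S \<and> ?b then x ?V else 0)"
    using fin by (auto simp: void_def sum.delta)
  finally show ?thesis .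
qed

lemma crq_cond_conj:
  assumes "finite S" "S \<noteq> {}"
  shows "crq (cond_conj A K x S) w
    = (if \<exists>i\<in>S. w \<in> K i - A i then 0 else (x({} := 1)) (void K S w))"
proof -
  let ?V = "void K S w"
  let ?false = "\<exists>i\<in>S. w \<in> K i - A i"
  have H: "w \<in> (\<Union>i\<in>S. K i) \<longleftrightarrow> ?V \<noteq> S"
    and all: "w \<in> (\<Inter>i\<in>S. A i \<inter> K i) \<longleftrightarrow> ?V = {} \<and> \<not> ?false"
    and rest: "(\<forall>i\<in>S - ?V. w \<in> A i) \<longleftrightarrow> \<not> ?false"
    and V: "?V = S \<Longrightarrow> \<not> ?false"
    by (auto simp: void_def)
  have "crq (cond_conj A K x S) w
    = (if ?V \<noteq> S then (if ?V = {} \<and> \<not> ?false then 1 else 0)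
        + (if ?V \<noteq> {} \<and> ?V \<noteq> S \<and> \<not> ?false then x ?V else 0) else x S)"
    unfolding cond_conj_def crq.simps sum_constituents [OF assms(1)] rest
    unfolding indicator_def Compl_iff H all
    by simp
  then show ?thesis
    using V assms(2) by (cases "?V = S"; cases "?V = {}"; cases ?false) auto
qed

lemma crq_cond_disj:
  assumes "finite S" "S \<noteq> {}"
  shows "crq (cond_disj A K y S) w
    = (if \<exists>i\<in>S. w \<in> K i \<inter> A i then 1 else (y({} := 0)) (void K S w))"
proof -
  let ?V = "void K S w"
  let ?true = "\<exists>i\<in>S. w \<in> K i \<inter> A i"
  have H: "w \<in> (\<Union>i\<in>S. K i) \<longleftrightarrow> ?V \<noteq> S"
    and some: "w \<in> (\<Union>i\<in>S. A i \<inter> K i) \<longleftrightarrow> ?true"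
    and rest: "(\<forall>i\<in>S - ?V. w \<in> - A i) \<longleftrightarrow> \<not> ?true"
    and V: "?V = S \<Longrightarrow> \<not> ?true"
    by (auto simp: void_def)
  have "crq (cond_disj A K y S) w
    = (if ?V \<noteq> S then (if ?true then 1 else 0)
        + (if ?V \<noteq> {} \<and> ?V \<noteq> S \<and> \<not> ?true then y ?V else 0) else y S)"
    unfolding cond_disj_def crq.simps sum_constituents [OF assms(1)] rest
    unfolding indicator_def Compl_iff H some
    by simp
  then show ?thesis
    using V assms(2) by (cases "?V = S"; cases "?V = {}"; cases ?true) auto
qed

section \<open>Inclusion-exclusion\<close>

lemma alternating_sum_Pow_eq_0:
  fixes g :: "'i set \<Rightarrow> real"
  assumes "finite S" "a \<in> S"
    and inv: "\<And>R. R \<subseteq> S - {a} \<Longrightarrow> g (insert a R) = g R"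
  shows "(\<Sum>R\<in>Pow S. (- 1) ^ (card R + 1) * g R) = 0"
proof -
  let ?P = "Pow (S - {a})"
  let ?t = "\<lambda>R. (- 1) ^ (card R + 1) * g R"
  have fin: "finite R" if "R \<in> ?P" for R
    using that assms(1) by (auto intro: finite_subset)
  have "Pow S = ?P \<union> insert a ` ?P"
    using Pow_insert [of a "S - {a}"] assms(2) by (simp add: insert_absorb)
  moreover have "?P \<inter> insert a ` ?P = {}"
    by auto
  ultimately have "sum ?t (Pow S) = sum ?t ?P + sum ?t (insert a ` ?P)"
    using assms(1) by (simp add: sum.union_disjoint)
  also have "sum ?t (insert a ` ?P) = (\<Sum>R\<in>?P. ?t (insert a R))"
    by (rule sum.reindex_cong [of "insert a"]) (auto simp: inj_on_def)
  also have "\<dots> = (\<Sum>R\<in>?P. - ?t R)"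
  proof (intro sum.cong refl)
    fix R assume R: "R \<in> ?P"
    then have "card (insert a R) = Suc (card R)"
      using fin [OF R] by (intro card_insert_disjoint) auto
    then show "?t (insert a R) = - ?t R"
      using inv R by simp
  qed
  finally show ?thesis
    by (simp add: sum_negf)
qed

lemma incl_excl_at_outcome:
  fixes x y :: "'i set \<Rightarrow> real"
  assumes S: "finite S" "S \<noteq> {}"
    and y: "void K S w \<noteq> {} \<Longrightarrow>
      y (void K S w) = (\<Sum>R | R \<noteq> {} \<and> R \<subseteq> void K S w. (- 1) ^ (card R + 1) * x R)"
  shows "crq (cond_disj A K y S) w
    = (\<Sum>R | R \<noteq> {} \<and> R \<subseteq> S. (- 1) ^ (card R + 1) * crq (cond_conj A K x R) w)"
proof -
  let ?V = "void K S w"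
  \<comment> \<open>The value of the conjunction over \<open>R\<close>, extended to \<open>R = {}\<close> by \<open>1\<close>, so that
      \<open>{a}\<close> has a partner too when the sets with and without a true member \<open>a\<close> are paired.\<close>
  define g where "g R = (if \<exists>i\<in>R. w \<in> K i - A i then 0 else (x({} := 1)) (void K R w))" for R
  have conj_eq: "(\<Sum>R | R \<noteq> {} \<and> R \<subseteq> S. (- 1) ^ (card R + 1) * crq (cond_conj A K x R) w)
      = (\<Sum>R | R \<noteq> {} \<and> R \<subseteq> S. (- 1) ^ (card R + 1) * g R)"
  proof (intro sum.cong refl)
    fix R assume "R \<in> {R. R \<noteq> {} \<and> R \<subseteq> S}"
    then have "finite R" "R \<noteq> {}"
      using S(1) by (auto intro: finite_subset)
    then have "crq (cond_conj A K x R) w = g R"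
      unfolding g_def by (rule crq_cond_conj)
    then show "(- 1) ^ (card R + 1) * crq (cond_conj A K x R) w = (- 1) ^ (card R + 1) * g R"
      by simp
  qed
  show ?thesis
  proof (cases "\<exists>i\<in>S. w \<in> K i \<inter> A i")
    case True
    then obtain a where a: "a \<in> S" "w \<in> K a" "w \<in> A a" by blast
    then have "void K (insert a R) w = void K R w" for R
      by (auto simp: void_def)
    then have "g (insert a R) = g R" for R
      using a by (auto simp: g_def)
    then have "0 = (\<Sum>R\<in>Pow S. (- 1) ^ (card R + 1) * g R)"
      using alternating_sum_Pow_eq_0 [OF S(1) a(1), of g] by simp
    also have "Pow S = insert {} {R. R \<noteq> {} \<and> R \<subseteq> S}"
      by auto
    also have "(\<Sum>R\<in>\<dots>. (- 1) ^ (card R + 1) * g R)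
        = - 1 + (\<Sum>R | R \<noteq> {} \<and> R \<subseteq> S. (- 1) ^ (card R + 1) * g R)"
      using S(1) by (simp add: g_def void_def)
    finally show ?thesis
      using True unfolding conj_eq crq_cond_disj [OF S] by auto
  next
    case False
    have "(\<Sum>R | R \<noteq> {} \<and> R \<subseteq> S. (- 1) ^ (card R + 1) * g R)
        = (\<Sum>R | R \<noteq> {} \<and> R \<subseteq> ?V. (- 1) ^ (card R + 1) * x R)"
    proof (rule sum.mono_neutral_cong_right)
      show "\<forall>R\<in>{R. R \<noteq> {} \<and> R \<subseteq> S} - {R. R \<noteq> {} \<and> R \<subseteq> ?V}. (- 1) ^ (card R + 1) * g R = 0"
      proof
        fix R assume "R \<in> {R. R \<noteq> {} \<and> R \<subseteq> S} - {R. R \<noteq> {} \<and> R \<subseteq> ?V}"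
        then obtain i where "i \<in> R" "i \<in> S" "w \<in> K i"
          unfolding void_def by blast
        with False have "\<exists>i\<in>R. w \<in> K i - A i"
          by blast
        then show "(- 1) ^ (card R + 1) * g R = 0"
          by (simp only: g_def if_True mult_zero_right)
      qed
      fix R assume R: "R \<in> {R. R \<noteq> {} \<and> R \<subseteq> ?V}"
      then have "void K R w = R" "\<not> (\<exists>i\<in>R. w \<in> K i - A i)"
        by (auto simp: void_def)
      then show "(- 1) ^ (card R + 1) * g R = (- 1) ^ (card R + 1) * x R"
        using R by (auto simp: g_def)
    qed (use S(1) in \<open>auto simp: void_def\<close>)
    also have "\<dots> = (y({} := 0)) ?V"
      using y by (cases "?V = {}") (auto intro: sum.neutral)
    finally show ?thesis
      using False unfolding conj_eq crq_cond_disj [OF S] by (simp only: if_False)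
  qed
qed

text \<open>
  Inclusion-exclusion for the previsions follows from the one for the random quantities on
  the union of the conditioning events, where only the previsions over smaller index sets
  are involved.
\<close>

lemma incl_excl_prevision:
  assumes coh: "coherent (assessment A K T x y z)" and "finite T"
    and "S \<noteq> {}" "S \<subseteq> T"
  shows "y S = (\<Sum>R | R \<noteq> {} \<and> R \<subseteq> S. (- 1) ^ (card R + 1) * x R)"
proof -
  have "finite S"
    using assms by (auto intro: finite_subset)
  then show ?thesis
    using assms(3,4)
  proof (induction S rule: finite_psubset_induct)
    case (psubset S)
    let ?N = "{R. R \<noteq> {} \<and> R \<subseteq> S}"
    \<comment> \<open>The disjunction takes the slot of the empty index set: the coefficients
        \<open>(- 1) ^ card R\<close> then give the disjunction minus the inclusion-exclusion sum.\<close>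
    define f where "f R = (if R = {} then cond_disj A K y S else cond_conj A K x R)" for R
    have Pow: "Pow S = insert {} ?N"
      by auto
    have fin: "finite ?N"
      using psubset.hyps by simp
    have "(\<Sum>R\<in>Pow S. (- 1) ^ card R * snd (snd (f R))) = 0"
    proof (rule coherent_linear [OF coh])
      have "f R \<in> assessment A K T x y z" if "R \<subseteq> S" for R
      proof (cases "R = {}")
        case True
        then have "f R = cond_disj A K y S"
          by (simp add: f_def)
        then show ?thesis
          using psubset.prems unfolding assessment_def by blast
      next
        case False
        then have "f R = cond_conj A K x R"
          by (simp add: f_def)
        then show ?thesis
          using psubset.prems that False unfolding assessment_def by blast
      qed
      then show "f ` Pow S \<subseteq> assessment A K T x y z"
        by blast
    next
      fix w assume "w \<in> (\<Union>R\<in>Pow S. fst (snd (f R)))"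
      then obtain i where "i \<in> S" "w \<in> K i"
        by (auto simp: f_def cond_disj_def cond_conj_def split: if_splits)
      then have "void K S w \<subset> S"
        by (auto simp: void_def)
      then have "crq (cond_disj A K y S) w
          = (\<Sum>R\<in>?N. (- 1) ^ (card R + 1) * crq (cond_conj A K x R) w)"
        using psubset by (intro incl_excl_at_outcome) auto
      then show "(\<Sum>R\<in>Pow S. (- 1) ^ card R * crq (f R) w) = 0"
        using fin by (simp add: Pow f_def sum_negf)
    qed (use psubset.hyps in auto)
    then show ?case
      using fin by (simp add: Pow f_def cond_disj_def cond_conj_def sum_negf)
  qed
qed

theorem theorem12:
  fixes n :: nat
    and E H :: "nat \<Rightarrow> 'w set"
    and x y :: "nat set \<Rightarrow> real"
    and z :: "nat \<Rightarrow> real"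
  assumes "n \<ge> 1"
    and "\<And>i. i \<in> {1..n} \<Longrightarrow> H i \<noteq> {}"
    and "coherent (assessment E H {1..n} x y z)"
  shows "crq (cond_disj E H y {1..n}) =
    (\<lambda>w. \<Sum>h = 1..n. (- 1) ^ (h + 1) *
           (\<Sum>S | S \<subseteq> {1..n} \<and> card S = h. crq (cond_conj E H x S) w))"
proof
  fix w
  let ?T = "{1..n}"
  let ?N = "{R. R \<noteq> {} \<and> R \<subseteq> ?T}"
  let ?C = "\<lambda>R. crq (cond_conj E H x R) w"
  have card: "card R \<in> {1..n}" if "R \<in> ?N" for R
  proof -
    have "finite R" "R \<noteq> {}" "card R \<le> card ?T"
      using that finite_subset [of R ?T] card_mono [of ?T R] by auto
    then show ?thesis
      by (simp add: Suc_le_eq card_gt_0_iff)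
  qed
  have "crq (cond_disj E H y ?T) w = (\<Sum>R\<in>?N. (- 1) ^ (card R + 1) * ?C R)"
    using assms(1)
    by (intro incl_excl_at_outcome incl_excl_prevision [OF assms(3)]) (auto simp: void_def)
  also have "\<dots> = (\<Sum>h = 1..n. \<Sum>R | R \<in> ?N \<and> card R = h. (- 1) ^ (card R + 1) * ?C R)"
  proof (rule sum.group [symmetric])
    show "card ` ?N \<subseteq> {1..n}"
      using card by blast
  qed simp_all
  also have "\<dots> = (\<Sum>h = 1..n. (- 1) ^ (h + 1) * (\<Sum>S | S \<subseteq> ?T \<and> card S = h. ?C S))"
    unfolding sum_distrib_left by (intro sum.cong refl) auto
  finally show "crq (cond_disj E H y ?T) w
      = (\<Sum>h = 1..n. (- 1) ^ (h + 1) * (\<Sum>S | S \<subseteq> ?T \<and> card S = h. ?C S))" .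
qed

end
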